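(* Let $\mathcal C$ be a category, $N\colon\mathcal C\to\mathcal C$ a functor, and $\eta\colon\mathrm{id}_{\mathcal C}\to N$ a natural transformation such that $N\eta\colon N\to N^2$ is a natural isomorphism. Let $\mathcal C_n$ be the full subcategory of $\mathcal C$ formed by those objects $x$ for which $\eta_x\colon x\to Nx$ is an isomorphism. If $g\colon x\to y$ is a morphism in $\mathcal C$ with $y\in\mathcal C_n$, then there is a unique morphism $g'\colon Nx\to y$ in $\mathcal C$ such that $g'\circ\eta_x=g$.
   Context: The natural transformation $N\eta\colon N\to N^2$ has components $(N\eta)_x:=N(\eta_x)\colon Nx\to N^2x$ for each object $x$ of $\mathcal C$. *)

theory Defs
  imports Main
begin

text \<open>Categories have a type of objects and a type of morphisms, with carrier sets inside these
  types; every morphism has a single domain and codomain. The value of \<open>Comp\<close> on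
  non-composable or non-member arguments is irrelevant. Composition is written in the usual order:
  \<open>g \<cdot> f\<close> is \<open>f\<close> followed by \<open>g\<close>.\<close>

record ('o, 'm) category_data =
  Obj :: "'o set"
  Mor :: "'m set"
  Dom :: "'m \<Rightarrow> 'o"
  Cod :: "'m \<Rightarrow> 'o"
  IdMor :: "'o \<Rightarrow> 'm"
  Comp :: "'m \<Rightarrow> 'm \<Rightarrow> 'm"  (infixr "\<cdot>\<index>" 70)

definition hom :: "('o, 'm, 'c) category_data_scheme \<Rightarrow> 'o \<Rightarrow> 'o \<Rightarrow> 'm set" where
  "hom C x y = {f \<in> Mor C. Dom C f = x \<and> Cod C f = y}"

locale category =
  fixes C :: "('o, 'm, 'c) category_data_scheme" (structure)
  assumes Dom_in_Obj: "f \<in> Mor C \<Longrightarrow> Dom C f \<in> Obj C"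
    and Cod_in_Obj: "f \<in> Mor C \<Longrightarrow> Cod C f \<in> Obj C"
    and Id_in_hom: "x \<in> Obj C \<Longrightarrow> IdMor C x \<in> hom C x x"
    and Comp_in_hom: "\<lbrakk>f \<in> hom C x y; g \<in> hom C y z\<rbrakk> \<Longrightarrow> g \<cdot> f \<in> hom C x z"
    and Comp_Id_right: "f \<in> hom C x y \<Longrightarrow> f \<cdot> IdMor C x = f"
    and Comp_Id_left: "f \<in> hom C x y \<Longrightarrow> IdMor C y \<cdot> f = f"
    and Comp_assoc: "\<lbrakk>f \<in> hom C w x; g \<in> hom C x y; h \<in> hom C y z\<rbrakk>
      \<Longrightarrow> (h \<cdot> g) \<cdot> f = h \<cdot> (g \<cdot> f)"

definition is_iso :: "('o, 'm, 'c) category_data_scheme \<Rightarrow> 'm \<Rightarrow> bool" where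
  "is_iso C f \<longleftrightarrow> f \<in> Mor C \<and>
    (\<exists>g \<in> hom C (Cod C f) (Dom C f).
      g \<cdot>\<^bsub>C\<^esub> f = IdMor C (Dom C f) \<and> f \<cdot>\<^bsub>C\<^esub> g = IdMor C (Cod C f))"

definition full_subcategory ::
  "('o, 'm, 'c) category_data_scheme \<Rightarrow> 'o set \<Rightarrow> ('o, 'm, 'c) category_data_scheme" where
  "full_subcategory C S =
    C\<lparr>Obj := Obj C \<inter> S, Mor := {f \<in> Mor C. Dom C f \<in> S \<and> Cod C f \<in> S}\<rparr>"

lemma category_full_subcategory:
  assumes "category C"
  shows "category (full_subcategory C S)"
proof -
  interpret category C by fact
  show ?thesis
    using Dom_in_Obj Cod_in_Obj Id_in_hom Comp_in_hom Comp_Id_right Comp_Id_left Comp_assoc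
    by unfold_locales (simp_all add: full_subcategory_def hom_def)
qed

record ('o, 'm, 'p, 'n) functor_data =
  ObjMap :: "'o \<Rightarrow> 'p"
  MorMap :: "'m \<Rightarrow> 'n"

locale category_functor = dom: category C + cod: category D
  for C :: "('o, 'm, 'c) category_data_scheme"
    and D :: "('p, 'n, 'd) category_data_scheme"
    and F :: "('o, 'm, 'p, 'n) functor_data" +
  assumes ObjMap_in_Obj: "x \<in> Obj C \<Longrightarrow> ObjMap F x \<in> Obj D"
    and MorMap_in_hom: "f \<in> hom C x y \<Longrightarrow> MorMap F f \<in> hom D (ObjMap F x) (ObjMap F y)"
    and MorMap_Id: "x \<in> Obj C \<Longrightarrow> MorMap F (IdMor C x) = IdMor D (ObjMap F x)"
    and MorMap_Comp: "\<lbrakk>f \<in> hom C x y; g \<in> hom C y z\<rbrakk>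
      \<Longrightarrow> MorMap F (g \<cdot>\<^bsub>C\<^esub> f) = MorMap F g \<cdot>\<^bsub>D\<^esub> MorMap F f"

definition id_functor :: "('o, 'm, 'o, 'm) functor_data" where
  "id_functor = \<lparr>ObjMap = (\<lambda>x. x), MorMap = (\<lambda>f. f)\<rparr>"

definition comp_functor ::
  "('p, 'n, 'q, 'k) functor_data \<Rightarrow> ('o, 'm, 'p, 'n) functor_data \<Rightarrow> ('o, 'm, 'q, 'k) functor_data"
  where "comp_functor G F =
    \<lparr>ObjMap = (\<lambda>x. ObjMap G (ObjMap F x)), MorMap = (\<lambda>f. MorMap G (MorMap F f))\<rparr>"

text \<open>A natural transformation is given by its family of components, indexed by objects.\<close>

locale natural_transformation = source: category_functor C D F + target: category_functor C D G
  for C :: "('o, 'm, 'c) category_data_scheme"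
    and D :: "('p, 'n, 'd) category_data_scheme"
    and F :: "('o, 'm, 'p, 'n) functor_data"
    and G :: "('o, 'm, 'p, 'n) functor_data"
    and \<tau> :: "'o \<Rightarrow> 'n" +
  assumes component_in_hom: "x \<in> Obj C \<Longrightarrow> \<tau> x \<in> hom D (ObjMap F x) (ObjMap G x)"
    and naturality: "f \<in> hom C x y \<Longrightarrow> \<tau> y \<cdot>\<^bsub>D\<^esub> MorMap F f = MorMap G f \<cdot>\<^bsub>D\<^esub> \<tau> x"

locale natural_isomorphism = natural_transformation +
  assumes component_iso: "x \<in> Obj C \<Longrightarrow> is_iso D (\<tau> x)"

definition whisker :: "('p, 'n, 'q, 'k) functor_data \<Rightarrow> ('o \<Rightarrow> 'n) \<Rightarrow> 'o \<Rightarrow> 'k" where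
  "whisker H \<tau> = (\<lambda>x. MorMap H (\<tau> x))"

text \<open>The full subcategory on the objects at which a natural transformation from the identity
  functor is invertible.\<close>

definition iso_subcategory ::
  "('o, 'm, 'c) category_data_scheme \<Rightarrow> ('o \<Rightarrow> 'm) \<Rightarrow> ('o, 'm, 'c) category_data_scheme" where
  "iso_subcategory C \<eta> = full_subcategory C {x \<in> Obj C. is_iso C (\<eta> x)}"

lemma category_functor_id: "category C \<Longrightarrow> category_functor C C id_functor"
  by (simp add: category_functor_def category_functor_axioms_def id_functor_def)

lemma category_functor_comp:
  assumes "category_functor C D F" and "category_functor D E G"
  shows "category_functor C E (comp_functor G F)"
proof -
  interpret F: category_functor C D F by fact
  interpret G: category_functor D E G by fact
  show ?thesis
    by unfold_locales
      (auto simp: comp_functor_def F.MorMap_Id G.MorMap_Id F.ObjMap_in_Obj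
        intro: F.ObjMap_in_Obj G.ObjMap_in_Obj F.MorMap_in_hom G.MorMap_in_hom
          F.MorMap_Comp[THEN arg_cong, THEN trans] G.MorMap_Comp)
qed

end

theory Submission
  imports Defs
begin

text \<open>Existence is naturality of \<open>\<eta>\<close>: the square \<open>\<eta>\<^sub>y \<cdot> g = N g \<cdot> \<eta>\<^sub>x\<close> forces the choice
  \<open>g' = \<eta>\<^sub>y\<inverse> \<cdot> N g\<close>. Uniqueness combines two observations. Since \<open>N \<eta>\<^sub>x\<close> is invertible, the equation
  \<open>g' \<cdot> \<eta>\<^sub>x = g\<close> determines \<open>N g'\<close> through \<open>N g' \<cdot> N \<eta>\<^sub>x = N g\<close>. Since \<open>\<eta>\<^sub>y\<close> is invertible, a
  morphism into \<open>y\<close> is determined by its image under \<open>N\<close> (lemma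
  \<open>MorMap_inj_on_hom_into_iso_object\<close>), so that \<open>N g'\<close> determines \<open>g'\<close>.\<close>

lemma (in category) iso_inverseE:
  assumes "is_iso C f" and "f \<in> hom C x y"
  obtains k where "k \<in> hom C y x" "k \<cdot> f = IdMor C x" "f \<cdot> k = IdMor C y"
  using assms by (auto simp: is_iso_def hom_def)

lemma (in category) iso_cancel_left:
  assumes "is_iso C f" and f: "f \<in> hom C x y"
    and a: "a \<in> hom C w x" and b: "b \<in> hom C w x" and eq: "f \<cdot> a = f \<cdot> b"
  shows "a = b"
proof -
  obtain k where k: "k \<in> hom C y x" "k \<cdot> f = IdMor C x"
    using iso_inverseE assms(1,2) by blast
  have "(k \<cdot> f) \<cdot> a = (k \<cdot> f) \<cdot> b"
    using Comp_assoc[OF a f k(1)] Comp_assoc[OF b f k(1)] eq by simp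
  then show ?thesis
    using Comp_Id_left[OF a] Comp_Id_left[OF b] k(2) by simp
qed

lemma (in category) iso_cancel_right:
  assumes "is_iso C f" and f: "f \<in> hom C x y"
    and a: "a \<in> hom C y z" and b: "b \<in> hom C y z" and eq: "a \<cdot> f = b \<cdot> f"
  shows "a = b"
proof -
  obtain k where k: "k \<in> hom C y x" "f \<cdot> k = IdMor C y"
    using iso_inverseE assms(1,2) by blast
  have "a \<cdot> (f \<cdot> k) = b \<cdot> (f \<cdot> k)"
    using Comp_assoc[OF k(1) f a] Comp_assoc[OF k(1) f b] eq by simp
  then show ?thesis
    using Comp_Id_right[OF a] Comp_Id_right[OF b] k(2) by simp
qed

text \<open>By naturality \<open>\<eta>\<^sub>y \<cdot> a = N a \<cdot> \<eta>\<^sub>w\<close>, so \<open>N a\<close> determines \<open>\<eta>\<^sub>y \<cdot> a\<close>, from which the invertible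
  \<open>\<eta>\<^sub>y\<close> can be cancelled.\<close>

lemma MorMap_inj_on_hom_into_iso_object:
  assumes "natural_transformation C C id_functor N \<eta>"
    and "y \<in> Obj C" and "is_iso C (\<eta> y)"
  shows "inj_on (MorMap N) (hom C w y)"
proof (rule inj_onI)
  interpret natural_transformation C C id_functor N \<eta> by fact
  fix a b assume a: "a \<in> hom C w y" and b: "b \<in> hom C w y" and eq: "MorMap N a = MorMap N b"
  have "\<eta> y \<in> hom C y (ObjMap N y)"
    using component_in_hom[OF assms(2)] by (simp add: id_functor_def)
  moreover have "\<eta> y \<cdot>\<^bsub>C\<^esub> a = \<eta> y \<cdot>\<^bsub>C\<^esub> b"
    using naturality[OF a] naturality[OF b] eq by (simp add: id_functor_def)
  ultimately show "a = b"
    using source.dom.iso_cancel_left assms(3) a b by blast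
qed

theorem proposition5p1:
  fixes C :: "('o, 'm) category_data"
    and N :: "('o, 'm, 'o, 'm) functor_data"
    and \<eta> :: "'o \<Rightarrow> 'm"
    and x y :: 'o
    and g :: 'm
  assumes "category C"
    and "category_functor C C N"
    and "natural_transformation C C id_functor N \<eta>"
    and "natural_isomorphism C C N (comp_functor N N) (whisker N \<eta>)"
    and "x \<in> Obj C"
    and "y \<in> Obj (iso_subcategory C \<eta>)"
    and "g \<in> hom C x y"
  shows "\<exists>!g'. g' \<in> hom C (ObjMap N x) y \<and> g' \<cdot>\<^bsub>C\<^esub> \<eta> x = g"
proof -
  interpret natural_transformation C C id_functor N \<eta> by fact
  interpret whiskered: natural_isomorphism C C N "comp_functor N N" "whisker N \<eta>" by fact
  have y: "y \<in> Obj C" "is_iso C (\<eta> y)"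
    using assms(6) by (auto simp: iso_subcategory_def full_subcategory_def)
  have eta: "\<eta> z \<in> hom C z (ObjMap N z)" if "z \<in> Obj C" for z
    using component_in_hom[OF that] by (simp add: id_functor_def)
  note eta_x = eta[OF assms(5)] and eta_y = eta[OF y(1)]
  note Ng = target.MorMap_in_hom[OF assms(7)]
  show ?thesis
  proof (rule ex_ex1I)
    obtain k where k: "k \<in> hom C (ObjMap N y) y" "k \<cdot>\<^bsub>C\<^esub> \<eta> y = IdMor C y"
      using source.dom.iso_inverseE[OF y(2) eta_y] by blast
    have "(k \<cdot>\<^bsub>C\<^esub> MorMap N g) \<cdot>\<^bsub>C\<^esub> \<eta> x = k \<cdot>\<^bsub>C\<^esub> (MorMap N g \<cdot>\<^bsub>C\<^esub> \<eta> x)"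
      by (rule source.dom.Comp_assoc[OF eta_x Ng k(1)])
    also have "\<dots> = k \<cdot>\<^bsub>C\<^esub> (\<eta> y \<cdot>\<^bsub>C\<^esub> g)"
      using naturality[OF assms(7)] by (simp add: id_functor_def)
    also have "\<dots> = (k \<cdot>\<^bsub>C\<^esub> \<eta> y) \<cdot>\<^bsub>C\<^esub> g"
      by (rule source.dom.Comp_assoc[OF assms(7) eta_y k(1), symmetric])
    also have "\<dots> = g"
      using k(2) source.dom.Comp_Id_left[OF assms(7)] by simp
    finally show "\<exists>g'. g' \<in> hom C (ObjMap N x) y \<and> g' \<cdot>\<^bsub>C\<^esub> \<eta> x = g"
      using source.dom.Comp_in_hom[OF Ng k(1)] by blast
  next
    fix a b
    assume a: "a \<in> hom C (ObjMap N x) y \<and> a \<cdot>\<^bsub>C\<^esub> \<eta> x = g"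
      and b: "b \<in> hom C (ObjMap N x) y \<and> b \<cdot>\<^bsub>C\<^esub> \<eta> x = g"
    have "is_iso C (MorMap N (\<eta> x))"
      using whiskered.component_iso[OF assms(5)] by (simp add: whisker_def)
    moreover have "MorMap N a \<cdot>\<^bsub>C\<^esub> MorMap N (\<eta> x) = MorMap N b \<cdot>\<^bsub>C\<^esub> MorMap N (\<eta> x)"
      using a b target.MorMap_Comp[OF eta_x] by metis
    ultimately have "MorMap N a = MorMap N b"
      using source.dom.iso_cancel_right target.MorMap_in_hom a b eta_x by blast
    then show "a = b"
      using inj_onD[OF MorMap_inj_on_hom_into_iso_object[OF assms(3) y]] a b by blast
  qed
qed

end
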